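(* Let $N,n\ge 1$ be integers and let $\vec l=(l^{(1)},\dots,l^{(N)})$, $l^{(i)}=(l^{(i)}_0,\dots,l^{(i)}_{N+n-1})\in\mathbb Z^{N+n}$, be charge vectors (so $\sum_{j=0}^{N+n-1} l^{(i)}_j=0$ for $i=1,\dots,N$) satisfying Condition (A) and Condition (B). Then the components $q_1,\dots,q_N$ of the associated local mirror map are integral power series: $$q_i\in z_i\,\mathbb Z[[z_1,\dots,z_N]],\qquad i=1,\dots,N.$$
   Context: The charge vectors are those of a torus action $(\mathbb C^* )^N$ on $\mathbb C^{N+n}$ by $(t_1,\dots,t_N)\cdot(z_j)_j=(\prod_i t_i^{l^{(i)}_j}z_j)_{j}$, whose quotient is a noncompact toric Calabi-Yau $n$-fold; the condition $\sum_j l^{(i)}_j=0$ is the Calabi-Yau condition. Let $\mathbb Z_+$ be the set of nonnegative integers. For $\vec m=(m_1,\dots,m_N)$ put $k_j(\vec l,\vec m)=\sum_{i=1}^N l^{(i)}_j m_i$ ($0\le j\le N+n-1$), and use the same formula $k_j(\vec l,\vec r)$ for formal parameters $\vec r=(r_1,\dots,r_N)$. For $\vec m\in\mathbb Z_+^N$ let $$N(\vec l,\vec m)=|\{j: 0\le j\le N+n-1,\ k_j(\vec l,\vec m)<0\}|.$$ Condition (A): for $\vec m\in\mathbb Z_+^N$, $N(\vec l,\vec m)=0$ implies $\vec m=\vec 0$. Condition (B): for every $\vec m\in\mathbb Z_+^N$ with $N(\vec l,\vec m)=1$ and $\gcd(m_1,\dots,m_N)=1$, one has $\gcd\{k_j(\vec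 l,\vec m): 0\le j\le N+n-1\}=1$. Here $z_1,\dots,z_N$ are formal variables. Define $$\omega=\sum_{\vec m\in\mathbb Z_+^N} c(\vec m,\vec r)\prod_{i=1}^N z_i^{r_i+m_i},\qquad c(\vec m,\vec r)=\frac{\prod_{j:\,k_j(\vec l,\vec m)<0}\ \prod_{b=0}^{-k_j(\vec l,\vec m)-1}(-b+k_j(\vec l,\vec r))}{\prod_{j:\,k_j(\vec l,\vec m)>0}\ \prod_{a=1}^{k_j(\vec l,\vec m)}(a+k_j(\vec l,\vec r))}.$$ Set $g_0=\omega|_{\vec r=0}$ and $g_1^{(i)}=\partial_{r_i}\omega|_{\vec r=0}$. Under Condition (A), $g_0=1$ and $$g_1^{(i)}=\log z_i+\sum_{\vec m\in\mathbb Z_+^N,\ N(\vec l,\vec m)=1} l^{(i)}_{j_{\vec m}}\,\frac{(-1)^{k_{j_{\vec m}}(\vec l,\vec m)+1}\,(-k_{j_{\vec m}}(\vec l,\vec m)-1)!}{\prod_{j\ne j_{\vec m}}k_j(\vec l,\vec m)!}\ \prod_{s=1}^N z_s^{m_s},$$ where $j_{\vec m}$ is the unique index $j$ with $k_j(\vec l,\vec m)<0$. The local mirror map is $q_i=\exp(g_1^{(i)}/g_0)$, i.e. $z_i$ times the exponential of the power series part of $g_1^{(i)}$. *)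

theory Defs
  imports "HOL-Analysis.Analysis"
begin

text \<open>
  The number of charge vectors is the cardinality of a finite index type \<open>'N\<close>; exponent vectors in
  \<open>\<int>\<^sub>+\<^sup>N\<close> are elements of \<open>nat ^ 'N\<close>.  The index \<open>j\<close> of a component of a charge vector ranges over
  \<open>{..<CARD('N) + n}\<close>; values of \<open>l i j\<close> outside this range are never used.
\<close>

section \<open>Formal power series in several variables\<close>

text \<open>A formal power series in variables \<open>z\<^sub>i\<close>, \<open>i :: 'N\<close>, is its family of coefficients.\<close>

type_synonym ('N, 'a) mfps = "nat ^ 'N \<Rightarrow> 'a"

definition mfps_one :: "('N::finite, 'a::comm_ring_1) mfps" where
  "mfps_one m = (if m = 0 then 1 else 0)"

definition mfps_var :: "'N::finite \<Rightarrow> ('N, 'a::comm_ring_1) mfps" where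
  "mfps_var i m = (if m = axis i 1 then 1 else 0)"

definition mfps_mult ::
  "('N::finite, 'a::comm_ring_1) mfps \<Rightarrow> ('N, 'a) mfps \<Rightarrow> ('N, 'a) mfps" where
  "mfps_mult f g m = (\<Sum>(a, b)\<in>{(a, b). a + b = m}. f a * g b)"

definition mfps_power :: "('N::finite, 'a::comm_ring_1) mfps \<Rightarrow> nat \<Rightarrow> ('N, 'a) mfps" where
  "mfps_power f k = (mfps_mult f ^^ k) mfps_one"

text \<open>Meaningful if the constant coefficient of \<open>g\<close> is invertible.\<close>

definition mfps_divide ::
  "('N::finite, 'a::comm_ring_1) mfps \<Rightarrow> ('N, 'a) mfps \<Rightarrow> ('N, 'a) mfps" where
  "mfps_divide f g = (THE h. mfps_mult h g = f)"

text \<open>If \<open>f\<close> has zero constant coefficient, the sum defining each coefficient is finite: the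
  summand vanishes when \<open>k\<close> exceeds the total degree of \<open>m\<close>.\<close>

definition mfps_exp :: "('N::finite, real) mfps \<Rightarrow> ('N, real) mfps" where
  "mfps_exp f m = (\<Sum>k. mfps_power f k m / fact k)"

definition mfps_integral :: "('N::finite, real) mfps \<Rightarrow> bool" where
  "mfps_integral f \<longleftrightarrow> (\<forall>m. f m \<in> \<int>)"

section \<open>Charge vectors\<close>

definition kform :: "('N::finite \<Rightarrow> nat \<Rightarrow> int) \<Rightarrow> 'a::comm_ring_1 ^ 'N \<Rightarrow> nat \<Rightarrow> 'a" where
  "kform l r j = (\<Sum>i\<in>UNIV. of_int (l i j) * r $ i)"

definition kint :: "('N::finite \<Rightarrow> nat \<Rightarrow> int) \<Rightarrow> nat ^ 'N \<Rightarrow> nat \<Rightarrow> int" where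
  "kint l m j = kform l (\<chi> i. int (m $ i)) j"

definition num_neg :: "('N::finite \<Rightarrow> nat \<Rightarrow> int) \<Rightarrow> nat \<Rightarrow> nat ^ 'N \<Rightarrow> nat" where
  "num_neg l n m = card {j. j < CARD('N) + n \<and> kint l m j < 0}"

definition calabi_yau :: "('N::finite \<Rightarrow> nat \<Rightarrow> int) \<Rightarrow> nat \<Rightarrow> bool" where
  "calabi_yau l n \<longleftrightarrow> (\<forall>i. (\<Sum>j<CARD('N) + n. l i j) = 0)"

definition condition_A :: "('N::finite \<Rightarrow> nat \<Rightarrow> int) \<Rightarrow> nat \<Rightarrow> bool" where
  "condition_A l n \<longleftrightarrow> (\<forall>m :: nat ^ 'N. num_neg l n m = 0 \<longrightarrow> m = 0)"

definition condition_B :: "('N::finite \<Rightarrow> nat \<Rightarrow> int) \<Rightarrow> nat \<Rightarrow> bool" where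
  "condition_B l n \<longleftrightarrow>
     (\<forall>m :: nat ^ 'N. num_neg l n m = 1 \<and> Gcd (range (($) m)) = 1 \<longrightarrow>
        Gcd (kint l m ` {..<CARD('N) + n}) = 1)"

section \<open>The local mirror map\<close>

definition c_coeff :: "('N::finite \<Rightarrow> nat \<Rightarrow> int) \<Rightarrow> nat \<Rightarrow> nat ^ 'N \<Rightarrow> real ^ 'N \<Rightarrow> real" where
  "c_coeff l n m r =
     (\<Prod>j | j < CARD('N) + n \<and> kint l m j < 0.
        \<Prod>b<nat (- kint l m j). - real b + kform l r j) /
     (\<Prod>j | j < CARD('N) + n \<and> kint l m j > 0.
        \<Prod>a = 1..nat (kint l m j). real a + kform l r j)"

text \<open>
  Writing \<open>L $ i\<close> for \<open>log z\<^sub>i\<close>, the monomial \<open>\<Prod>\<^sub>i z\<^sub>i\<close> to the power \<open>r\<^sub>i + m\<^sub>i\<close> is \<open>z\<^sup>m\<close> times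
  \<open>exp (\<Sum>\<^sub>i r\<^sub>i L\<^sub>i)\<close>.  Thus \<open>\<omega>\<close> is a power series in \<open>z\<close> whose coefficients are functions of
  \<open>r\<close> and of the logarithms \<open>L\<close>.
\<close>

definition omega ::
  "('N::finite \<Rightarrow> nat \<Rightarrow> int) \<Rightarrow> nat \<Rightarrow> real ^ 'N \<Rightarrow> real ^ 'N \<Rightarrow> ('N, real) mfps" where
  "omega l n L r m = c_coeff l n m r * exp (\<Sum>i\<in>UNIV. r $ i * L $ i)"

definition g0 :: "('N::finite \<Rightarrow> nat \<Rightarrow> int) \<Rightarrow> nat \<Rightarrow> real ^ 'N \<Rightarrow> ('N, real) mfps" where
  "g0 l n L = omega l n L 0"

text \<open>The partial derivative in \<open>r\<^sub>i\<close> at \<open>r = 0\<close>, taken coefficientwise.\<close>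

definition g1 :: "('N::finite \<Rightarrow> nat \<Rightarrow> int) \<Rightarrow> nat \<Rightarrow> real ^ 'N \<Rightarrow> 'N \<Rightarrow> ('N, real) mfps" where
  "g1 l n L i m = deriv (\<lambda>t. omega l n L (axis i t) m) 0"

lemma g0_log_free: "g0 l n L = g0 l n 0"
  by (simp add: g0_def omega_def fun_eq_iff)

lemma kform_axis: "kform l (axis i t) j = of_int (l i j) * (t::real)"
proof -
  have "(\<Sum>x\<in>UNIV. of_int (l x j) * axis i t $ x) = (\<Sum>x\<in>UNIV. if x = i then of_int (l i j) * t else 0)"
    by (rule sum.cong) (auto simp: axis_def)
  then show ?thesis by (simp add: kform_def)
qed

lemma c_coeff_differentiable:
  "(\<lambda>t. c_coeff l n m (axis i t)) field_differentiable (at 0)"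
proof -
  have P: "(\<lambda>t::real. \<Prod>x\<in>S. f x t) field_differentiable (at 0)"
    if "\<And>x. x \<in> S \<Longrightarrow> f x field_differentiable (at 0)" for f S
    using that by (induction S rule: infinite_finite_induct)
      (auto intro!: derivative_intros field_differentiable_mult)
  show ?thesis
    unfolding c_coeff_def kform_axis
    by (intro field_differentiable_divide P)
       (auto intro!: derivative_intros field_differentiable_add field_differentiable_mult
          simp: prod_zero_iff)
qed

text \<open>The logarithms enter \<open>g\<^sub>1\<close> only through the summand \<open>log z\<^sub>i \<cdot> g\<^sub>0\<close>.\<close>

lemma g1_log:
  fixes l :: "'N::finite \<Rightarrow> nat \<Rightarrow> int"
  shows "g1 l n L i m = L $ i * g0 l n L m + g1 l n 0 i m"
proof -
  let ?c = "\<lambda>t. c_coeff l n m (axis i t)"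
  have ax: "(\<Sum>x\<in>UNIV. axis i t $ x * M $ x) = t * M $ i" for t :: real and M
  proof -
    have "(\<Sum>x\<in>UNIV. axis i t $ x * M $ x) = (\<Sum>x\<in>UNIV. if x = i then t * M $ i else 0)"
      by (rule sum.cong) (auto simp: axis_def)
    then show ?thesis by simp
  qed
  have ax0: "axis i 0 = (0 :: real ^ 'N)"
    by (simp add: axis_def vec_eq_iff)
  have c: "(?c has_field_derivative deriv ?c 0) (at 0)"
    using c_coeff_differentiable by (rule field_differentiable_derivI)
  have "g1 l n M i m = M $ i * g0 l n M m + deriv ?c 0" for M
    unfolding g1_def g0_def omega_def ax
    by (rule DERIV_imp_deriv) (rule derivative_eq_intros c refl | simp add: ax0)+
  from this[of L] this[of 0] show ?thesis by simp
qed

text \<open>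
  By the preceding lemma \<open>g\<^sub>1 / g\<^sub>0\<close> is \<open>log z\<^sub>i\<close> plus its power series part, which is obtained by
  setting the logarithms to \<open>0\<close>; exponentiating, \<open>exp (log z\<^sub>i)\<close> is the variable \<open>z\<^sub>i\<close>.
\<close>

definition mirror_map :: "('N::finite \<Rightarrow> nat \<Rightarrow> int) \<Rightarrow> nat \<Rightarrow> 'N \<Rightarrow> ('N, real) mfps" where
  "mirror_map l n i = mfps_mult (mfps_var i) (mfps_exp (mfps_divide (g1 l n 0 i) (g0 l n 0)))"

end

theory Submission
  imports Defs "HOL-Number_Theory.Cong"
begin

text \<open>
  Under Condition (A) the series \<open>g\<^sub>0\<close> is \<open>1\<close>, so up to the factor \<open>z\<^sub>i\<close> the mirror map is the exponential
  of the power series part \<open>G\<close> of \<open>g\<^sub>1\<close>.  A power series \<open>G\<close> without constant term can be written as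
  \<open>\<Sum>\<^sub>v a\<^sub>v * (- log (1 - z\<^sup>v))\<close>, with \<open>v\<close> ranging over the nonzero exponent vectors, and then \<open>exp G\<close> is the
  product of the factors \<open>1 - z\<^sup>v\<close> raised to the powers \<open>- a\<^sub>v\<close>.  If all \<open>a\<^sub>v\<close> are integers, \<open>exp G\<close> is
  integral.

  The exponents \<open>a\<^sub>v\<close> are computed separately on each ray through a primitive vector \<open>v\<close>: putting
  \<open>b e = e * G (e v)\<close>, they are determined by the equations that, for each \<open>e\<close>, the sum
  of \<open>d\<close> times the exponent at \<open>d v\<close> over the divisors \<open>d\<close> of \<open>e\<close> is \<open>b e\<close>.  The solution is integral if
  \<open>b\<close> takes integer values and satisfies the Gauss congruences \<open>b (p\<^sup>s t) \<equiv> b (p\<^sup>s\<^sup>-\<^sup>1 t)\<close> modulo \<open>p\<^sup>s\<close>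
  (\<open>gauss_congruences_divisor_sum\<close>, \<open>mfps_exp_integral\<close>).

  For the mirror map, \<open>b\<close> vanishes unless exactly one \<open>k\<^sub>j\<close> of \<open>v\<close>, say \<open>- K\<close>, is negative.  In that
  case the Calabi-Yau condition shows that the other \<open>k\<^sub>j\<close> add up to \<open>K\<close>, and \<open>b e\<close> is, up to sign and an
  integer factor, the multinomial coefficient \<open>(e K)! / \<Prod>\<^sub>j (e k\<^sub>j)!\<close> divided by \<open>K\<close>
  (\<open>g1_rays\<close>).  Condition (B) makes this quotient an integer (\<open>sum_dvd_multinomial\<close>).  The
  Gauss congruences hold because passing from \<open>e\<close> to \<open>p * e\<close> multiplies it by a \<open>p\<close>-adic unit
  congruent to \<open>1\<close> modulo \<open>p\<^sup>s\<close> (\<open>reduced_multinomial_cong\<close>).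
\<close>

section \<open>Power series by total degree\<close>

definition mdeg :: "nat ^ 'N::finite \<Rightarrow> nat" where
  "mdeg m = (\<Sum>i\<in>UNIV. m $ i)"

lemma mdeg_zero [simp]: "mdeg 0 = 0"
  by (simp add: mdeg_def)

lemma mdeg_add [simp]: "mdeg (a + b) = mdeg a + mdeg b"
  by (simp add: mdeg_def sum.distrib)

lemma mdeg_scale [simp]: "mdeg (d *s v) = d * mdeg v"
  by (simp add: mdeg_def sum_distrib_left)

lemma mdeg_eq_0_iff [simp]: "mdeg m = 0 \<longleftrightarrow> m = 0"
  by (simp add: mdeg_def vec_eq_iff)

lemma component_le_mdeg: "m $ i \<le> mdeg m"
  unfolding mdeg_def by (rule member_le_sum) auto

lemma finite_mdeg_le [simp]: "finite {m :: nat ^ 'N::finite. mdeg m \<le> D}"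
proof -
  have "finite (PiE (UNIV :: 'N set) (\<lambda>_. {..D}))"
    by (intro finite_PiE) auto
  moreover have "vec_nth ` {m :: nat ^ 'N. mdeg m \<le> D} \<subseteq> PiE UNIV (\<lambda>_. {..D})"
    using component_le_mdeg le_trans by fastforce
  moreover have "inj_on vec_nth {m :: nat ^ 'N. mdeg m \<le> D}"
    by (simp add: inj_on_def vec_nth_inject)
  ultimately show ?thesis
    by (meson finite_imageD finite_subset)
qed

lemma finite_decompositions [simp]: "finite {(a, b). a + b = (m :: nat ^ 'N::finite)}"
proof (rule finite_subset)
  show "{(a, b). a + b = m} \<subseteq> {a. mdeg a \<le> mdeg m} \<times> {b. mdeg b \<le> mdeg m}"
    by auto
qed simp

lemma finite_decompositions' [simp]: "finite {p. fst p + snd p = (m :: nat ^ 'N::finite)}"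
  using finite_decompositions[of m] by (simp add: case_prod_unfold)

lemma mfps_mult_commute: "mfps_mult f g = mfps_mult g f"
proof
  show "mfps_mult f g m = mfps_mult g f m" for m
    unfolding mfps_mult_def
    by (rule sum.reindex_bij_witness[of _ prod.swap prod.swap]) (auto simp: ac_simps)
qed

lemma mfps_mult_assoc: "mfps_mult (mfps_mult f g) h = mfps_mult f (mfps_mult g h)"
proof
  fix m
  have "mfps_mult (mfps_mult f g) h m =
      (\<Sum>(p, q)\<in>(SIGMA p:{(a, b). a + b = m}. {(c, d). c + d = fst p}).
        f (fst q) * g (snd q) * h (snd p))"
    unfolding mfps_mult_def
    by (subst sum.Sigma[symmetric]) (auto simp: sum_distrib_right case_prod_unfold)
  also have "\<dots> = (\<Sum>(p, q)\<in>(SIGMA p:{(a, b). a + b = m}. {(c, d). c + d = snd p}).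
        f (fst p) * (g (fst q) * h (snd q)))"
    by (rule sum.reindex_bij_witness
        [of _ "\<lambda>((a, b), (c, d)). ((a + c, d), (a, c))" "\<lambda>((a, b), (c, d)). ((c, d + b), (d, b))"])
       (auto simp: ac_simps)
  also have "\<dots> = mfps_mult f (mfps_mult g h) m"
    unfolding mfps_mult_def
    by (subst sum.Sigma[symmetric]) (auto simp: sum_distrib_left case_prod_unfold)
  finally show "mfps_mult (mfps_mult f g) h m = mfps_mult f (mfps_mult g h) m" .
qed

lemma mfps_mult_left_commute: "mfps_mult f (mfps_mult g h) = mfps_mult g (mfps_mult f h)"
  by (metis mfps_mult_assoc mfps_mult_commute)

lemma mfps_mult_one_right [simp]: "mfps_mult f mfps_one = f"
proof
  fix m :: "nat ^ 'a"
  have "mfps_mult f mfps_one m = (\<Sum>(a, b)\<in>{(m, 0 :: nat ^ 'a)}. f a * mfps_one b)"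
    unfolding mfps_mult_def
    by (rule sum.mono_neutral_right) (auto simp: mfps_one_def split: if_splits)
  then show "mfps_mult f mfps_one m = f m"
    by (simp add: mfps_one_def)
qed

lemma mfps_mult_add_left: "mfps_mult (\<lambda>m. f m + g m) h m = mfps_mult f h m + mfps_mult g h m"
  by (simp add: mfps_mult_def case_prod_unfold distrib_right sum.distrib)

lemma mfps_mult_scale_right: "mfps_mult f (\<lambda>m. c * g m) m = c * mfps_mult f g m"
  by (simp add: mfps_mult_def case_prod_unfold sum_distrib_left mult.left_commute)

lemma mfps_mult_const [simp]: "mfps_mult f g 0 = f 0 * g 0"
proof -
  have "mfps_mult f g 0 = (\<Sum>(a, b)\<in>{(0, 0)}. f a * g b)"
    unfolding mfps_mult_def by (rule sum.cong) (auto simp: vec_eq_iff)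
  then show ?thesis by simp
qed

lemma mfps_divide_one: "mfps_divide f mfps_one = f"
  by (simp add: mfps_divide_def)

section \<open>The exponential and the Euler derivation\<close>

text \<open>
  The derivation \<open>\<Sum>\<^sub>i z\<^sub>i \<partial>/\<partial>z\<^sub>i\<close>: a monomial is an eigenvector whose eigenvalue is its degree.
  It is injective on series without constant coefficient, which is why a first-order equation for
  it determines a series from its constant coefficient.
\<close>
definition euler :: "('N::finite, real) mfps \<Rightarrow> ('N, real) mfps" where
  "euler f m = real (mdeg m) * f m"

lemma euler_mult:
  "euler (mfps_mult f g) m = mfps_mult (euler f) g m + mfps_mult f (euler g) m"
  unfolding euler_def mfps_mult_def sum_distrib_left sum.distrib[symmetric]
  by (rule sum.cong) (auto simp: algebra_simps)

lemma euler_mfps_one [simp]: "euler mfps_one m = 0"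
  by (simp add: euler_def mfps_one_def)

lemma euler_power:
  "euler (mfps_power f (Suc k)) m = real (Suc k) * mfps_mult (euler f) (mfps_power f k) m"
proof (induction k arbitrary: m)
  case 0
  show ?case by (simp add: mfps_power_def)
next
  case (Suc k)
  have *: "euler (mfps_power f (Suc k)) = (\<lambda>m. real (Suc k) * mfps_mult (euler f) (mfps_power f k) m)"
    using Suc.IH by blast
  have P: "mfps_power f (Suc n) = mfps_mult f (mfps_power f n)" for n
    by (simp add: mfps_power_def)
  have "euler (mfps_power f (Suc (Suc k))) m =
      mfps_mult (euler f) (mfps_power f (Suc k)) m + mfps_mult f (euler (mfps_power f (Suc k))) m"
    by (simp only: P[of "Suc k"] euler_mult)
  also have "mfps_mult f (euler (mfps_power f (Suc k))) m =
      real (Suc k) * mfps_mult (euler f) (mfps_power f (Suc k)) m"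
    unfolding * mfps_mult_scale_right by (simp add: P mfps_mult_left_commute)
  finally show ?case by (simp add: algebra_simps)
qed

lemma mfps_mult_eq_0_low_degree:
  assumes "f 0 = 0" "\<And>b. mdeg b < k \<Longrightarrow> g b = 0" "mdeg m < Suc k"
  shows "mfps_mult f g m = 0"
  unfolding mfps_mult_def
proof (rule sum.neutral, clarify)
  fix a b assume "m = a + b"
  show "f a * g b = 0"
  proof (cases "a = 0")
    case False
    then have "mdeg a \<noteq> 0" by simp
    then have "mdeg b < k" using assms(3) unfolding \<open>m = a + b\<close> mdeg_add by linarith
    then show ?thesis using assms(2) by simp
  qed (simp add: assms(1))
qed

lemma mfps_power_eq_0:
  assumes "f 0 = 0" "mdeg m < k"
  shows "mfps_power f k m = 0"
  using assms(2)
proof (induction k arbitrary: m)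
  case (Suc k)
  then show ?case
    using mfps_mult_eq_0_low_degree[of f k "mfps_power f k" m] assms(1)
    by (simp add: mfps_power_def)
qed simp

lemma mfps_exp_finite_sum:
  assumes "f 0 = 0" "mdeg m \<le> D"
  shows "mfps_exp f m = (\<Sum>k\<le>D. mfps_power f k m / fact k)"
  unfolding mfps_exp_def
  by (rule suminf_finite) (use assms mfps_power_eq_0[of f m] in auto)

lemma mfps_exp_const: "f 0 = 0 \<Longrightarrow> mfps_exp f 0 = 1"
  by (subst mfps_exp_finite_sum[where D = 0]) (auto simp: mfps_power_def mfps_one_def)

text \<open>
  Differentiating the exponential series term by term shifts its index by one.  In a fixed degree
  all sums are finite; taking one more term on the left than on the right makes the shift exact.
\<close>
lemma euler_mfps_exp:
  assumes "f 0 = 0"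
  shows "euler (mfps_exp f) m = mfps_mult (euler f) (mfps_exp f) m"
proof -
  define D where "D = mdeg m"
  have "euler (mfps_exp f) m = (\<Sum>k\<le>Suc D. euler (mfps_power f k) m / fact k)"
    unfolding euler_def
    by (subst mfps_exp_finite_sum[where D = "Suc D"]) (use assms in \<open>auto simp: D_def sum_distrib_left simp del: sum.atMost_Suc\<close>)
  also have "\<dots> = (\<Sum>k\<le>D. euler (mfps_power f (Suc k)) m / fact (Suc k))"
    by (subst sum.atMost_Suc_shift) (simp add: mfps_power_def)
  also have "\<dots> = (\<Sum>k\<le>D. mfps_mult (euler f) (mfps_power f k) m / fact k)"
    by (simp add: euler_power del: of_nat_Suc)
  also have "\<dots> = (\<Sum>(a, b)\<in>{(a, b). a + b = m}. euler f a * (\<Sum>k\<le>D. mfps_power f k b / fact k))"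
    unfolding mfps_mult_def sum_divide_distrib case_prod_unfold sum_distrib_left
    by (subst sum.swap) simp
  also have "\<dots> = mfps_mult (euler f) (mfps_exp f) m"
    unfolding mfps_mult_def
    by (rule sum.cong) (auto simp: mfps_exp_finite_sum[of f _ D, OF assms] D_def)
  finally show ?thesis .
qed

text \<open>
  Comparing coefficients in \<open>euler E = euler g * E\<close> gives \<open>mdeg m * E m\<close> in terms of the values of
  \<open>E\<close> in lower degree.  With all hypotheses restricted to degrees up to that of \<open>m\<close> and with \<open>g\<close>
  in the place of \<open>f\<close>, the lemma serves both to identify exponentials and to show that they depend
  on low-degree coefficients only.
\<close>
lemma mfps_exp_unique:
  assumes f: "f 0 = 0" "E 0 = 1"
    and E: "\<And>a. mdeg a \<le> mdeg m \<Longrightarrow> euler E a = mfps_mult (euler g) E a"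
    and fg: "\<And>a. mdeg a \<le> mdeg m \<Longrightarrow> g a = f a"
  shows "mfps_exp f m = E m"
  using E fg
proof (induction "mdeg m" arbitrary: m rule: less_induct)
  case less
  show ?case
  proof (cases "m = 0")
    case True
    then show ?thesis using f by (simp add: mfps_exp_const)
  next
    case False
    have "euler (mfps_exp f) m = mfps_mult (euler f) (mfps_exp f) m"
      by (rule euler_mfps_exp[of f, OF f(1)])
    also have "\<dots> = mfps_mult (euler g) E m"
      unfolding mfps_mult_def
    proof (rule sum.cong, simp, clarify)
      fix a b assume m: "m = a + b"
      show "euler f a * mfps_exp f b = euler g a * E b"
      proof (cases "a = 0")
        case False
        then have "mdeg a \<noteq> 0" by simp
        then have "mdeg b < mdeg m" unfolding m mdeg_add by linarith
        then have "mfps_exp f b = E b"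
          by (intro less) auto
        moreover have "f a = g a"
          using less.prems(2)[of a] by (simp add: m)
        ultimately show ?thesis by (simp add: euler_def)
      qed (simp add: euler_def)
    qed
    also have "\<dots> = euler E m" using less.prems by simp
    finally show ?thesis using False by (simp add: euler_def)
  qed
qed

lemma mfps_exp_cong:
  assumes "f 0 = 0" "\<And>a. mdeg a \<le> mdeg m \<Longrightarrow> g a = f a"
  shows "mfps_exp f m = mfps_exp g m"
proof -
  have "g 0 = 0" using assms(1) assms(2)[of 0] by simp
  then show ?thesis
    using assms by (intro mfps_exp_unique[where g = g and E = "mfps_exp g"])
      (auto simp: mfps_exp_const euler_mfps_exp)
qed

text \<open>
  By the product rule the product of the exponentials solves the equation of the sum.
\<close>
lemma mfps_exp_add:
  assumes "f 0 = 0" "g 0 = 0"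
  shows "mfps_exp (\<lambda>m. f m + g m) = mfps_mult (mfps_exp f) (mfps_exp g)"
proof
  fix m
  let ?E = "mfps_mult (mfps_exp f) (mfps_exp g)"
  have e: "euler (mfps_exp f) = mfps_mult (euler f) (mfps_exp f)"
    "euler (mfps_exp g) = mfps_mult (euler g) (mfps_exp g)"
    using assms euler_mfps_exp by blast+
  have "euler ?E a = mfps_mult (euler (\<lambda>m. f m + g m)) ?E a" for a
  proof -
    have "euler (\<lambda>m. f m + g m) = (\<lambda>m. euler f m + euler g m)"
      by (simp add: euler_def fun_eq_iff algebra_simps)
    then show ?thesis
      unfolding euler_mult e
      by (simp add: mfps_mult_add_left mfps_mult_assoc
          mfps_mult_left_commute[of "mfps_exp f" "euler g"])
  qed
  then show "mfps_exp (\<lambda>m. f m + g m) m = ?E m"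
    using assms by (intro mfps_exp_unique) (auto simp: mfps_exp_const)
qed

lemma mfps_exp_zero: "mfps_exp (\<lambda>_. 0) = mfps_one"
proof
  show "mfps_exp (\<lambda>_. 0) m = mfps_one m" for m :: "nat ^ 'a"
    by (rule mfps_exp_unique[where g = "\<lambda>_. 0"])
       (auto simp: mfps_one_def mfps_mult_def euler_def)
qed

section \<open>Series with integral exponential\<close>

lemma mfps_integral_mult:
  "mfps_integral f \<Longrightarrow> mfps_integral g \<Longrightarrow> mfps_integral (mfps_mult f g)"
  unfolding mfps_integral_def mfps_mult_def by (auto intro!: Ints_sum)

lemma mfps_integral_one: "mfps_integral mfps_one"
  by (simp add: mfps_integral_def mfps_one_def)

text \<open>
  Solving \<open>f * g = 1\<close> for the coefficients of \<open>g\<close> degree by degree divides only by the constant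
  coefficient of \<open>f\<close>.
\<close>
lemma mfps_integral_inverse:
  assumes fg: "mfps_mult f g = mfps_one" and f: "mfps_integral f" "f 0 = 1"
  shows "mfps_integral g"
  unfolding mfps_integral_def
proof
  show "g m \<in> \<int>" for m
  proof (induction "mdeg m" arbitrary: m rule: less_induct)
    case less
    have "mfps_one m = (\<Sum>(a, b)\<in>{(a, b). a + b = m}. f a * g b)"
      using fg by (metis mfps_mult_def)
    also have "\<dots> = g m + (\<Sum>(a, b)\<in>{(a, b). a + b = m} - {(0, m)}. f a * g b)"
      by (subst sum.remove[of _ "(0, m)"]) (auto simp: f)
    finally have "g m = mfps_one m - (\<Sum>(a, b)\<in>{(a, b). a + b = m} - {(0, m)}. f a * g b)"
      by simp
    moreover have "f a * g b \<in> \<int>" if m: "a + b = m" "(a, b) \<noteq> (0, m)" for a b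
    proof -
      have "mdeg a \<noteq> 0" using that by auto
      then have "mdeg b < mdeg m" unfolding m(1)[symmetric] mdeg_add by linarith
      then show "f a * g b \<in> \<int>"
        using less f by (auto simp: mfps_integral_def)
    qed
    then have "(\<Sum>(a, b)\<in>{(a, b). a + b = m} - {(0, m)}. f a * g b) \<in> \<int>"
      by (intro Ints_sum) auto
    ultimately show ?case
      by (auto simp: mfps_one_def)
  qed
qed

text \<open>
  These series form an additive group, because exponentiation turns sums into products and
  opposites into inverses.  The vanishing constant coefficient is what makes the exponential a
  formal power series.
\<close>
definition exp_integral :: "('N::finite, real) mfps \<Rightarrow> bool" where
  "exp_integral f \<longleftrightarrow> f 0 = 0 \<and> mfps_integral (mfps_exp f)"

lemma exp_integral_add:
  "exp_integral f \<Longrightarrow> exp_integral g \<Longrightarrow> exp_integral (\<lambda>m. f m + g m)"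
  by (simp add: exp_integral_def mfps_exp_add mfps_integral_mult)

lemma exp_integral_zero: "exp_integral (\<lambda>_. 0)"
  by (simp add: exp_integral_def mfps_exp_zero mfps_integral_one)

lemma exp_integral_uminus:
  assumes "exp_integral f"
  shows "exp_integral (\<lambda>m. - f m)"
proof -
  have f: "f 0 = 0" "mfps_integral (mfps_exp f)"
    using assms by (auto simp: exp_integral_def)
  have "mfps_mult (mfps_exp f) (mfps_exp (\<lambda>m. - f m)) = mfps_one"
    using mfps_exp_add[of f "\<lambda>m. - f m"] f by (simp add: mfps_exp_zero)
  then show ?thesis
    using mfps_integral_inverse[of "mfps_exp f"] f by (auto simp: exp_integral_def mfps_exp_const)
qed

lemma exp_integral_scale_int:
  assumes "exp_integral f"
  shows "exp_integral (\<lambda>m. of_int c * f m)"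
proof (induction c rule: int_induct[where k = 0])
  case base
  show ?case by (simp add: exp_integral_zero)
next
  case (step1 i)
  show ?case using exp_integral_add[OF step1(2) assms] by (simp add: algebra_simps)
next
  case (step2 i)
  show ?case using exp_integral_add[OF step2(2) exp_integral_uminus[OF assms]]
    by (simp add: algebra_simps)
qed

lemma exp_integral_sum:
  assumes "finite S" "\<And>v. v \<in> S \<Longrightarrow> exp_integral (f v)"
  shows "exp_integral (\<lambda>m. \<Sum>v\<in>S. f v m)"
  using assms by (induction S) (auto simp: exp_integral_zero exp_integral_add)

lemma scale_right_inject:
  fixes v :: "nat ^ 'N::finite"
  assumes "v \<noteq> 0"
  shows "d *s v = e *s v \<longleftrightarrow> d = e"
proof
  assume "d *s v = e *s v"
  then have "mdeg (d *s v) = mdeg (e *s v)" by simp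
  then show "d = e" using assms by simp
qed simp

text \<open>
  This is \<open>- log (1 - z\<^sup>v)\<close>; for \<open>v \<noteq> 0\<close> at most one \<open>d\<close> contributes to each coefficient.
\<close>
definition log_series :: "nat ^ 'N::finite \<Rightarrow> ('N, real) mfps" where
  "log_series v m = (\<Sum>d | d \<ge> 1 \<and> d *s v = m. 1 / real d)"

lemma log_series_eq_0: "(\<And>d. d \<ge> 1 \<Longrightarrow> m \<noteq> d *s v) \<Longrightarrow> log_series v m = 0"
proof -
  assume "\<And>d. d \<ge> 1 \<Longrightarrow> m \<noteq> d *s v"
  then have "{d. d \<ge> 1 \<and> d *s v = m} = {}" by auto
  then show ?thesis by (simp only: log_series_def sum.empty)
qed

lemma log_series_0:
  assumes "v \<noteq> 0"
  shows "log_series v 0 = 0"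
proof (rule log_series_eq_0)
  fix d :: nat assume "d \<ge> 1"
  then have "mdeg (d *s v) \<noteq> 0" using assms by simp
  then show "0 \<noteq> d *s v" by (metis mdeg_zero)
qed

lemma log_series_scale:
  assumes "v \<noteq> 0" "d \<ge> 1"
  shows "log_series v (d *s v) = 1 / real d"
proof -
  have "{e. e \<ge> 1 \<and> e *s v = d *s v} = {d}"
    using assms by (auto simp: scale_right_inject)
  then show ?thesis by (simp add: log_series_def)
qed

lemma euler_log_series:
  assumes "v \<noteq> 0"
  shows "euler (log_series v) m = (if \<exists>d\<ge>1. m = d *s v then real (mdeg v) else 0)"
proof (cases "\<exists>d\<ge>1. m = d *s v")
  case True
  then obtain d where "d \<ge> 1" "m = d *s v" by blast
  then show ?thesis using assms by (auto simp: euler_def log_series_scale)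
next
  case False
  then have "log_series v m = 0" by (intro log_series_eq_0) blast
  then show ?thesis unfolding if_not_P[OF False] by (simp add: euler_def)
qed

lemma scale_Suc: "Suc d *s v = d *s v + (v :: nat ^ 'N::finite)"
  by (simp add: vec_eq_iff)

lemma scale_one: "Suc 0 *s v = (v :: nat ^ 'N::finite)"
  by (simp add: vec_eq_iff)

text \<open>
  The Euler derivation of \<open>log_series v\<close> is \<open>mdeg v\<close> times the geometric series
  \<open>z\<^sup>v + z\<^sup>2\<^sup>v + \<dots>\<close>, and multiplying it by \<open>1 - z\<^sup>v\<close> telescopes.  Hence \<open>1 - z\<^sup>v\<close> satisfies the
  equation that characterises the exponential.
\<close>
lemma exp_neg_log_series:
  fixes v :: "nat ^ 'N::finite"
  assumes "v \<noteq> 0"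
  shows "mfps_exp (\<lambda>m. - log_series v m) = (\<lambda>m. mfps_one m - (if m = v then 1 else 0))"
proof
  fix m
  let ?E = "\<lambda>m. mfps_one m - (if m = v then 1 else 0) :: real"
  let ?R = "\<lambda>m. \<exists>d\<ge>1. m = d *s v"
  have E: "euler ?E m = mfps_mult (euler (\<lambda>m. - log_series v m)) ?E m" for m
  proof -
    let ?L = "\<lambda>m. if ?R m then real (mdeg v) else 0"
    have "euler (\<lambda>m. - log_series v m) = (\<lambda>m. - ?L m)"
      using euler_log_series[OF assms] by (auto simp: euler_def fun_eq_iff)
    then have "mfps_mult (euler (\<lambda>m. - log_series v m)) ?E m =
        (\<Sum>(a, b)\<in>{(a, b). a + b = m}. ?L a * (if b = v then 1 else 0)) - mfps_mult ?L mfps_one m"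
      unfolding mfps_mult_def sum_subtractf[symmetric]
      by (intro sum.cong) (auto simp: algebra_simps)
    also have "mfps_mult ?L mfps_one m = ?L m" by simp
    \<comment> \<open>Multiplication by \<open>z\<^sup>v\<close> shifts the progression \<open>v, 2v, \<dots>\<close> to \<open>2v, 3v, \<dots>\<close>.\<close>
    also have "(\<Sum>(a, b)\<in>{(a, b). a + b = m}. ?L a * (if b = v then 1 else 0)) =
        (if \<exists>d\<ge>2. m = d *s v then real (mdeg v) else 0)"
    proof (cases "\<exists>a. m = a + v")
      case True
      then obtain a where a: "m = a + v" by blast
      have "(\<Sum>(a, b)\<in>{(a, b). a + b = m}. ?L a * (if b = v then 1 else 0)) =
        (\<Sum>(a, b)\<in>{(a, v)}. ?L a * (if b = v then 1 else 0))"
        by (rule sum.mono_neutral_right) (auto simp: a split: if_splits)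
      also have "\<dots> = ?L a" by simp
      also have "?R a \<longleftrightarrow> (\<exists>d\<ge>2. m = d *s v)"
      proof
        assume "?R a"
        then obtain d where "d \<ge> 1" "a = d *s v" by blast
        then have "Suc d \<ge> 2" "m = Suc d *s v" by (simp_all add: a scale_Suc)
        then show "\<exists>d\<ge>2. m = d *s v" by blast
      next
        assume "\<exists>d\<ge>2. m = d *s v"
        then obtain d where d: "d \<ge> 2" "m = d *s v" by blast
        then obtain d' where d': "d = Suc d'" "d' \<ge> 1" by (cases d) auto
        then show "?R a" using d a by (auto simp: scale_Suc)
      qed
      finally show ?thesis .
    next
      case False
      have "\<not> (\<exists>d\<ge>2. m = d *s v)"
      proof
        assume "\<exists>d\<ge>2. m = d *s v"
        then obtain d where d: "d \<ge> 2" "m = d *s v" by blast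
        then obtain d' where "d = Suc d'" by (cases d) auto
        then show False using d False by (auto simp: scale_Suc)
      qed
      then show ?thesis using False by (auto intro!: sum.neutral)
    qed
    also have "(if \<exists>d\<ge>2. m = d *s v then real (mdeg v) else 0) - ?L m =
        (if m = v then - real (mdeg v) else 0)"
    proof -
      have 1: "v = d *s v \<longleftrightarrow> d = 1" for d
        using scale_right_inject[OF assms, of 1 d] by (auto simp: scale_one)
      have "?R m \<longleftrightarrow> m = v \<or> (\<exists>d\<ge>2. m = d *s v)"
      proof
        assume "?R m"
        then obtain d where d: "d \<ge> 1" "m = d *s v" by blast
        show "m = v \<or> (\<exists>d\<ge>2. m = d *s v)"
        proof (cases "d = 1")
          case False
          then have "d \<ge> 2" using d by simp
          then show ?thesis using d by blast
        qed (use d in \<open>simp add: scale_one\<close>)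
      next
        show "m = v \<or> (\<exists>d\<ge>2. m = d *s v) \<Longrightarrow> ?R m"
          by (metis "1" le_numeral_extra(4) one_le_numeral order_trans)
      qed
      then show ?thesis using 1 by auto
    qed
    also have "\<dots> = euler ?E m"
      by (auto simp: euler_def mfps_one_def)
    finally show ?thesis by simp
  qed
  show "mfps_exp (\<lambda>m. - log_series v m) m = ?E m"
    by (rule mfps_exp_unique[where g = "\<lambda>m. - log_series v m"])
       (use log_series_0 assms E in \<open>auto simp: mfps_one_def\<close>)
qed

lemma exp_integral_log_series:
  assumes "v \<noteq> 0"
  shows "exp_integral (log_series v)"
proof -
  have "exp_integral (\<lambda>m. - log_series v m)"
    unfolding exp_integral_def exp_neg_log_series[OF assms]
    using log_series_0[OF assms] by (auto simp: mfps_integral_def mfps_one_def)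
  from exp_integral_uminus[OF this] show ?thesis by simp
qed

section \<open>Gauss congruences\<close>

text \<open>
  A form of \<open>b (p\<^sup>s t) \<equiv> b (p\<^sup>s\<^sup>-\<^sup>1 t)\<close> modulo \<open>p\<^sup>s\<close> without negative exponents: \<open>e\<close> stands for
  \<open>p\<^sup>s\<^sup>-\<^sup>1 t\<close>.
\<close>
definition gauss_congruences :: "(nat \<Rightarrow> int) \<Rightarrow> bool" where
  "gauss_congruences b \<longleftrightarrow>
     (\<forall>p e s. prime p \<longrightarrow> e > 0 \<longrightarrow> p ^ s dvd p * e \<longrightarrow> [b (p * e) = b e] (mod int (p ^ s)))"

text \<open>
  The series \<open>\<Sum>\<^sub>e b e / e * x\<^sup>e\<close> is the logarithm of a product whose \<open>d\<close>-th factor is \<open>1 - x\<^sup>d\<close> raised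
  to a power \<open>- a\<^sub>d\<close> if and only if \<open>b e\<close> is the sum of \<open>d * a\<^sub>d\<close> over the divisors \<open>d\<close> of \<open>e\<close>.
  The recursion solves these equations for \<open>a\<^sub>d\<close>; its division is exact when the Gauss congruences
  hold.
\<close>
fun product_exponent :: "(nat \<Rightarrow> int) \<Rightarrow> nat \<Rightarrow> int" where
  "product_exponent b e =
     (b e - (\<Sum>d | d dvd e \<and> d < e. int d * product_exponent b d)) div int e"

declare product_exponent.simps [simp del]

text \<open>
  The point is that \<open>e\<close> divides the numerator in the recursion, and this is checked one prime power
  \<open>p\<^sup>s\<close> exactly dividing \<open>e = p * e'\<close> at a time.  The divisors \<open>d\<close> of \<open>e\<close> that are not divisible by
  \<open>p\<^sup>s\<close> are the divisors of \<open>e'\<close> with that property, so modulo \<open>p\<^sup>s\<close> the terms of proper divisors add up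
  to \<open>b e'\<close>, by induction, and \<open>b e - b e'\<close> is divisible by \<open>p\<^sup>s\<close>, by the congruence.
\<close>
lemma gauss_congruences_divisor_sum:
  assumes b: "gauss_congruences b" and "e > 0"
  shows "b e = (\<Sum>d | d dvd e. int d * product_exponent b d)"
  using \<open>e > 0\<close>
proof (induction e rule: less_induct)
  case (less e)
  let ?t = "\<lambda>d. int d * product_exponent b d"
  let ?r = "b e - (\<Sum>d | d dvd e \<and> d < e. ?t d)"
  have "int e dvd ?r"
  proof (cases "?r = 0")
    case r: False
    have "e dvd nat \<bar>?r\<bar>"
    proof (rule multiplicity_le_imp_dvd)
      fix p :: nat assume p: "prime p"
      define s where "s = multiplicity p e"
      have "p ^ s dvd nat \<bar>?r\<bar>"
      proof (cases "s = 0")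
        case False
        then obtain e' where e: "e = p * e'"
          using p by (metis dvd_def not_dvd_imp_multiplicity_0 s_def)
        then have e': "e' > 0" "e' < e"
          using less.prems p prime_gt_1_nat[of p] by auto
        have ps: "p ^ s dvd p * e'"
          unfolding e[symmetric] s_def by (rule multiplicity_dvd)
        \<comment> \<open>A divisor \<open>d\<close> of \<open>e\<close> also divides \<open>e / p\<close> unless \<open>p\<close> has in \<open>d\<close> the full multiplicity \<open>s\<close>.\<close>
        have dvd_iff: "d dvd e \<and> d < e \<and> \<not> p ^ s dvd d \<longleftrightarrow> d dvd e' \<and> \<not> p ^ s dvd d" for d
        proof
          assume d: "d dvd e \<and> d < e \<and> \<not> p ^ s dvd d"
          have "multiplicity p d < s"
            using d p multiplicity_dvd' not_le by blast
          moreover obtain c where c: "e = d * c" using d by blast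
          moreover have "c \<noteq> 0" "d \<noteq> 0" using c less.prems by auto
          ultimately have "multiplicity p c > 0"
            using p unfolding s_def by (simp add: prime_elem_multiplicity_mult_distrib)
          then have "p dvd c" by (metis not_dvd_imp_multiplicity_0 less_numeral_extra(3))
          then obtain c' where "c = p * c'" by blast
          then have "e' = d * c'" using c e p by (simp add: prime_gt_0_nat)
          then show "d dvd e' \<and> \<not> p ^ s dvd d" using d by simp
        next
          assume d: "d dvd e' \<and> \<not> p ^ s dvd d"
          then have "d \<le> e'" using e' by (intro dvd_imp_le) auto
          then have "d < e" using e' by simp
          then show "d dvd e \<and> d < e \<and> \<not> p ^ s dvd d"
            using d e by (simp add: dvd_mult)
        qed
        have dv: "int (p ^ s) dvd (\<Sum>d | d dvd x \<and> P d \<and> p ^ s dvd d. ?t d)" for x P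
          by (intro dvd_sum dvd_mult2) (simp del: of_nat_power)
        have split: "(\<Sum>d | d dvd x \<and> P d. ?t d) =
            (\<Sum>d | d dvd x \<and> P d \<and> p ^ s dvd d. ?t d) + (\<Sum>d | d dvd x \<and> P d \<and> \<not> p ^ s dvd d. ?t d)"
          if "x > 0" for x P
          using that by (subst sum.union_disjoint[symmetric]) (auto intro!: sum.cong)
        have 1: "(\<Sum>d | d dvd e \<and> d < e. ?t d) = (\<Sum>d | d dvd e \<and> d < e \<and> p ^ s dvd d. ?t d) +
            (\<Sum>d | d dvd e' \<and> \<not> p ^ s dvd d. ?t d)"
          using split[OF less.prems, of "\<lambda>d. d < e"] unfolding dvd_iff .
        have 2: "b e' = (\<Sum>d | d dvd e' \<and> p ^ s dvd d. ?t d) + (\<Sum>d | d dvd e' \<and> \<not> p ^ s dvd d. ?t d)"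
          using less.IH[OF e'(2,1)] split[OF e'(1), of "\<lambda>_. True"] by simp
        have diff: "int (p ^ s) dvd b e - b e'"
          using b p e' ps unfolding gauss_congruences_def e by (simp add: cong_iff_dvd_diff)
        have dv': "int (p ^ s) dvd (\<Sum>d | d dvd e' \<and> p ^ s dvd d. ?t d)"
          using dv[of e' "\<lambda>_. True"] by simp
        have r_eq: "?r = (b e - b e') + (\<Sum>d | d dvd e' \<and> p ^ s dvd d. ?t d)
            - (\<Sum>d | d dvd e \<and> d < e \<and> p ^ s dvd d. ?t d)"
          unfolding 1 using 2 by linarith
        have "int (p ^ s) dvd ?r"
          unfolding r_eq by (rule dvd_diff[OF dvd_add[OF diff dv'] dv[of e "\<lambda>d. d < e"]])
        then show ?thesis by (subst int_dvd_int_iff[symmetric]) simp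
      qed simp
      then show "multiplicity p e \<le> multiplicity p (nat \<bar>?r\<bar>)"
        unfolding s_def using p r
        by (intro multiplicity_geI) (auto simp: prime_gt_1_nat)
    qed (use less.prems in simp)
    then show ?thesis by (simp add: dvd_nat_abs_iff)
  qed simp
  then have "int e * product_exponent b e = ?r"
    by (subst product_exponent.simps) simp
  moreover have "{d. d dvd e} = insert e {d. d dvd e \<and> d < e}"
    using less.prems dvd_imp_le by (auto simp: order_le_less)
  ultimately show ?case by simp
qed

section \<open>Multinomial coefficients divided by their top argument\<close>

definition coprime_fact :: "nat \<Rightarrow> nat \<Rightarrow> nat" where
  "coprime_fact p a = (\<Prod>i | i \<in> {1..a} \<and> \<not> p dvd i. i)"

lemma coprime_coprime_fact:
  assumes "prime p"
  shows "coprime (coprime_fact p a) p"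
  unfolding coprime_fact_def using assms
  by (intro prod_coprime_left) (auto simp: coprime_commute[of _ p] intro: prime_imp_coprime)

lemma fact_mult_prime:
  assumes "prime p"
  shows "fact (p * a) = p ^ a * fact a * coprime_fact p (p * a)"
proof -
  have "fact (p * a) = (\<Prod>i\<in>{1..p * a}. i)" by (simp add: fact_prod)
  also have "\<dots> = (\<Prod>i\<in>(*) p ` {1..a} \<union> {i. i \<in> {1..p * a} \<and> \<not> p dvd i}. i)"
  proof (rule prod.cong)
    show "{1..p * a} = (*) p ` {1..a} \<union> {i \<in> {1..p * a}. \<not> p dvd i}" (is "?A = ?B")
    proof
      show "?A \<subseteq> ?B"
      proof
        fix x assume x: "x \<in> ?A"
        show "x \<in> ?B"
        proof (cases "p dvd x")
          case True
          then obtain y where "x = p * y" by blast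
          then have "x = p * y" "y \<in> {1..a}" using x by (auto simp: Suc_le_eq)
          then show ?thesis by blast
        qed (use x in auto)
      qed
      show "?B \<subseteq> ?A" using assms by (auto simp: Suc_le_eq prime_gt_0_nat)
    qed
  qed simp
  also have "\<dots> = (\<Prod>i\<in>(*) p ` {1..a}. i) * coprime_fact p (p * a)"
    unfolding coprime_fact_def by (rule prod.union_disjoint) auto
  also have "(\<Prod>i\<in>(*) p ` {1..a}. i) = p ^ a * fact a"
    using assms by (subst prod.reindex) (auto simp: inj_on_def prod.distrib fact_prod prime_gt_0_nat)
  finally show ?thesis .
qed

text \<open>
  The factors come in \<open>x\<close> blocks of length \<open>q\<close>, and all blocks are the same modulo \<open>q\<close>.
\<close>
lemma coprime_fact_power_cong:
  assumes "p dvd q"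
  shows "[coprime_fact p (q * x) = coprime_fact p q ^ x] (mod q)"
proof (induction x)
  case (Suc x)
  have "coprime_fact p (q * Suc x) =
      (\<Prod>i\<in>{i. i \<in> {1..q * x} \<and> \<not> p dvd i} \<union> {i. i \<in> {q * x + 1..q * x + q} \<and> \<not> p dvd i}. i)"
    unfolding coprime_fact_def by (rule prod.cong) auto
  also have "\<dots> = coprime_fact p (q * x) * (\<Prod>i | i \<in> {q * x + 1..q * x + q} \<and> \<not> p dvd i. i)"
    unfolding coprime_fact_def by (rule prod.union_disjoint) auto
  also have "(\<Prod>i | i \<in> {q * x + 1..q * x + q} \<and> \<not> p dvd i. i) =
      (\<Prod>i | i \<in> {1..q} \<and> \<not> p dvd i. q * x + i)"
  proof (rule prod.reindex_bij_witness[of _ "\<lambda>i. q * x + i" "\<lambda>i. i - q * x"])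
    fix i assume i: "i \<in> {i \<in> {q * x + 1..q * x + q}. \<not> p dvd i}"
    then have "p dvd i \<longleftrightarrow> p dvd (i - q * x)"
      using assms by (metis (no_types, lifting) add_leD1 atLeastAtMost_iff dvd_diffD dvd_diff_nat dvd_mult2 mem_Collect_eq)
    then show "i - q * x \<in> {i \<in> {1..q}. \<not> p dvd i}" using i by auto
  qed (use assms in \<open>auto simp: dvd_add_right_iff\<close>)
  also have "[coprime_fact p (q * x) * (\<Prod>i | i \<in> {1..q} \<and> \<not> p dvd i. q * x + i) =
      coprime_fact p q ^ x * (\<Prod>i | i \<in> {1..q} \<and> \<not> p dvd i. i)] (mod q)"
    by (intro cong_mult Suc.IH cong_prod) (simp add: cong_def)
  finally show ?case by (simp add: coprime_fact_def mult.commute)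
qed (simp add: coprime_fact_def)

definition multinomial :: "'b set \<Rightarrow> ('b \<Rightarrow> nat) \<Rightarrow> nat" where
  "multinomial J k = fact (\<Sum>j\<in>J. k j) div (\<Prod>j\<in>J. fact (k j))"

lemma multinomial_mult:
  assumes "finite J"
  shows "multinomial J k * (\<Prod>j\<in>J. fact (k j)) = fact (\<Sum>j\<in>J. k j)"
proof -
  have "(\<Prod>j\<in>J. fact (k j)) dvd (fact (\<Sum>j\<in>J. k j) :: nat)"
    using assms
  proof (induction J)
    case (insert x J)
    have "fact (k x) * (\<Prod>j\<in>J. fact (k j)) dvd (fact (k x) * fact (\<Sum>j\<in>J. k j) :: nat)"
      by (intro mult_dvd_mono insert.IH dvd_refl)
    also have "\<dots> dvd fact (k x + (\<Sum>j\<in>J. k j))"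
      by (rule fact_fact_dvd_fact)
    finally show ?case
      using insert.hyps by simp
  qed simp
  then show ?thesis by (simp add: multinomial_def)
qed

text \<open>
  Lowering the argument \<open>e * k j\<close> by one divides the multinomial coefficient by
  \<open>e * (\<Sum>j\<in>J. k j)\<close> and multiplies it by \<open>e * k j\<close>.  The result is an integer, so the sum divides the
  product of the multinomial coefficient with each \<open>k j\<close>, hence its product with their greatest
  common divisor.
\<close>
lemma sum_dvd_multinomial:
  assumes J: "finite J" and e: "e > 0" and gcd: "Gcd (k ` J) = 1"
  shows "(\<Sum>j\<in>J. k j) dvd multinomial J (\<lambda>j. e * k j)"
proof -
  let ?M = "multinomial J (\<lambda>j. e * k j)" and ?K = "\<Sum>j\<in>J. k j"
  have "?K dvd ?M * k j" if j: "j \<in> J" for j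
  proof (cases "k j = 0")
    case False
    define k' where "k' = (\<lambda>i. e * k i)(j := e * k j - 1)"
    have pos: "e * k j > 0" using e False by simp
    have K: "(\<Sum>i\<in>J. e * k i) = Suc (\<Sum>i\<in>J. k' i)"
      using J j pos by (simp add: sum.remove[of J j] k'_def)
    have P: "(\<Prod>i\<in>J. fact (e * k i)) = e * k j * (\<Prod>i\<in>J. fact (k' i) :: nat)"
      using J j pos fact_reduce[of "e * k j", where 'a = nat]
      by (simp add: prod.remove[of J j] k'_def)
    have "(?M * k j) * (e * (\<Prod>i\<in>J. fact (k' i))) = fact (\<Sum>i\<in>J. e * k i)"
      using multinomial_mult[OF J, of "\<lambda>j. e * k j"] unfolding P by (simp add: ac_simps)
    also have "\<dots> = (\<Sum>i\<in>J. e * k i) * fact (\<Sum>i\<in>J. k' i)"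
      unfolding K by simp
    also have "\<dots> = (?K * multinomial J k') * (e * (\<Prod>i\<in>J. fact (k' i)))"
      using multinomial_mult[OF J, of k'] by (simp add: sum_distrib_left[symmetric] ac_simps)
    finally have "?M * k j = ?K * multinomial J k'"
      using e J by simp
    then show ?thesis by simp
  qed simp
  then have "?K dvd Gcd ((*) ?M ` k ` J)"
    by (intro Gcd_greatest) auto
  then show ?thesis by (simp add: Gcd_mult gcd)
qed

text \<open>
  In the power series part of \<open>g\<^sub>1\<close>, the coefficient of \<open>z\<^sup>e\<^sup>v\<close> multiplied by \<open>e\<close> is, up to sign, a component
  of a charge vector times a number of this form.  The division is exact when the values of \<open>k\<close>
  have no common divisor.
\<close>
definition reduced_multinomial :: "'b set \<Rightarrow> ('b \<Rightarrow> nat) \<Rightarrow> nat \<Rightarrow> nat" where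
  "reduced_multinomial J k e = multinomial J (\<lambda>j. e * k j) div (\<Sum>j\<in>J. k j)"

lemma reduced_multinomial_mult:
  assumes "finite J" "e > 0" "Gcd (k ` J) = 1"
  shows "(\<Sum>j\<in>J. k j) * reduced_multinomial J k e = multinomial J (\<lambda>j. e * k j)"
  using sum_dvd_multinomial[OF assms] by (simp add: reduced_multinomial_def)

text \<open>
  Separating the multiples of \<open>p\<close> in every factorial shows that the multinomial coefficients at
  \<open>p * e\<close> and at \<open>e\<close> differ by a factor that is a quotient of products of numbers prime to \<open>p\<close>.  Modulo \<open>p\<^sup>s\<close> the
  numerator and the denominator of this quotient are the same power of one unit, because the
  arguments below add up to the argument above.  Both multinomial coefficients are the same multiple
  of the reduced ones, and that multiple cancels from an exact identity before any congruence is
  taken; so its own divisibility by \<open>p\<close> does no harm.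
\<close>
lemma reduced_multinomial_cong:
  assumes J: "finite J" and gcd: "Gcd (k ` J) = 1" and p: "prime p" and e: "e > 0"
    and ps: "p ^ s dvd p * e"
  shows "[reduced_multinomial J k (p * e) = reduced_multinomial J k e] (mod p ^ s)"
proof (cases "s = 0")
  case False
  let ?R = "reduced_multinomial J k" and ?K = "\<Sum>j\<in>J. k j"
  obtain t where t: "p * e = p ^ s * t" using ps by blast
  define u where "u = coprime_fact p (p ^ s)"
  have K: "?K > 0"
  proof (rule ccontr)
    assume "\<not> ?K > 0"
    then have "k ` J \<subseteq> {0}" using J by auto
    then show False using gcd by (metis Gcd_0_iff zero_neq_one)
  qed
  have F: "[coprime_fact p (p * (e * x)) = u ^ (t * x)] (mod p ^ s)" for x
    using coprime_fact_power_cong[of p "p ^ s" "t * x"] False t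
    by (simp add: u_def mult.assoc[symmetric])
  have M: "multinomial J (\<lambda>j. p * (e * k j)) * (\<Prod>j\<in>J. coprime_fact p (p * (e * k j))) =
      multinomial J (\<lambda>j. e * k j) * coprime_fact p (p * (e * ?K))"
  proof -
    let ?c = "p ^ (e * ?K) * (\<Prod>j\<in>J. fact (e * k j))"
    have "multinomial J (\<lambda>j. p * (e * k j)) * (\<Prod>j\<in>J. coprime_fact p (p * (e * k j))) * ?c =
        multinomial J (\<lambda>j. p * (e * k j)) * (\<Prod>j\<in>J. fact (p * (e * k j)))"
      unfolding fact_mult_prime[OF p] prod.distrib power_sum sum_distrib_left by (simp only: ac_simps)
    also have "\<dots> = fact (p * (e * ?K))"
      by (simp add: multinomial_mult[OF J] sum_distrib_left)
    also have "\<dots> = p ^ (e * ?K) * fact (e * ?K) * coprime_fact p (p * (e * ?K))"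
      by (rule fact_mult_prime[OF p])
    also have "fact (e * ?K) = multinomial J (\<lambda>j. e * k j) * (\<Prod>j\<in>J. fact (e * k j))"
      by (simp add: multinomial_mult[OF J] sum_distrib_left)
    also have "p ^ (e * ?K) * (multinomial J (\<lambda>j. e * k j) * (\<Prod>j\<in>J. fact (e * k j))) * coprime_fact p (p * (e * ?K)) =
      multinomial J (\<lambda>j. e * k j) * coprime_fact p (p * (e * ?K)) * ?c"
      by (simp add: ac_simps)
    finally show ?thesis using p J by (simp add: prime_gt_0_nat)
  qed
  have "?K * (?R (p * e) * (\<Prod>j\<in>J. coprime_fact p (p * (e * k j)))) =
      ?K * (?R e * coprime_fact p (p * (e * ?K)))"
    using M reduced_multinomial_mult[OF J _ gcd, of "p * e"] reduced_multinomial_mult[OF J e gcd] p e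
    by (simp add: mult.assoc[symmetric] prime_gt_0_nat)
  then have R: "?R (p * e) * (\<Prod>j\<in>J. coprime_fact p (p * (e * k j))) =
      ?R e * coprime_fact p (p * (e * ?K))"
    using K by simp
  have "[(\<Prod>j\<in>J. coprime_fact p (p * (e * k j))) = (\<Prod>j\<in>J. u ^ (t * k j))] (mod p ^ s)"
    by (rule cong_prod) (rule F)
  also have "(\<Prod>j\<in>J. u ^ (t * k j)) = u ^ (t * ?K)"
    by (simp add: power_sum sum_distrib_left)
  finally have "[?R (p * e) * u ^ (t * ?K) = ?R (p * e) * (\<Prod>j\<in>J. coprime_fact p (p * (e * k j)))] (mod p ^ s)"
    by (intro cong_mult cong_refl) (simp add: cong_sym)
  also have "[?R (p * e) * (\<Prod>j\<in>J. coprime_fact p (p * (e * k j))) = ?R e * u ^ (t * ?K)] (mod p ^ s)"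
    unfolding R by (intro cong_mult cong_refl F)
  finally show ?thesis
    using coprime_coprime_fact[OF p, of "p ^ s"]
    by (subst (asm) cong_mult_rcancel_nat) (auto simp: u_def)
qed simp

text \<open>
  The sign can differ between \<open>p * e\<close> and \<open>e\<close> only if \<open>p = 2\<close> and \<open>e\<close> is odd; then \<open>p\<^sup>s\<close> is at most
  \<open>2\<close> and signs are invisible.
\<close>
lemma gauss_congruences_signed_reduced_multinomial:
  assumes J: "finite J" and gcd: "Gcd (k ` J) = 1"
  shows "gauss_congruences (\<lambda>e. c * (- 1) ^ (e * K + 1) * int (reduced_multinomial J k e))"
  unfolding gauss_congruences_def
proof (intro allI impI)
  fix p e s assume p: "prime (p :: nat)" and e: "e > 0" and ps: "p ^ s dvd p * e"
  have R: "[int (reduced_multinomial J k (p * e)) = int (reduced_multinomial J k e)] (mod int (p ^ s))"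
    using reduced_multinomial_cong[OF J gcd p e ps] by (simp only: cong_int_iff)
  have S: "[(- 1) ^ (p * e * K + 1) = (- 1 :: int) ^ (e * K + 1)] (mod int (p ^ s))"
  proof (cases "even (p * e * K) = even (e * K)")
    case False
    then have "even p" "odd e" by auto
    then have "p = 2" using p by (metis primes_dvd_imp_eq two_is_prime_nat)
    moreover have "s \<le> 1"
    proof (rule ccontr)
      assume "\<not> s \<le> 1"
      then have "2 ^ 2 dvd p ^ s" unfolding \<open>p = 2\<close> by (intro le_imp_power_dvd) simp
      then have "2 * 2 dvd 2 * e" using ps \<open>p = 2\<close> by (metis dvd_trans power2_eq_square)
      then show False using \<open>odd e\<close> by simp
    qed
    ultimately have "int (p ^ s) dvd 2" by (cases s) auto
    moreover have "[(- 1) ^ (p * e * K + 1) = (- 1 :: int) ^ (e * K + 1)] (mod 2)"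
      by (simp add: cong_iff_dvd_diff minus_one_power_iff)
    ultimately show ?thesis by (meson cong_dvd_modulus)
  qed (simp add: minus_one_power_iff)
  show "[c * (- 1) ^ (p * e * K + 1) * int (reduced_multinomial J k (p * e)) =
      c * (- 1) ^ (e * K + 1) * int (reduced_multinomial J k e)] (mod int (p ^ s))"
    by (intro cong_mult R S cong_refl)
qed

section \<open>Integral exponentials from congruences along rays\<close>

text \<open>
  Every nonzero exponent vector is a positive multiple of a unique vector of content \<open>1\<close>.  A series
  in several variables thus splits into series in one variable, one for each primitive direction.
\<close>
definition content :: "nat ^ 'N::finite \<Rightarrow> nat" where
  "content m = Gcd (range (($) m))"

definition primitive_part :: "nat ^ 'N::finite \<Rightarrow> nat ^ 'N" where
  "primitive_part m = (\<chi> i. m $ i div content m)"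

lemma content_scale: "content (d *s m) = d * content m"
proof -
  have "range (($) (d *s m)) = (*) d ` range (($) m)"
    by (simp add: image_image)
  then show ?thesis by (simp add: content_def Gcd_mult)
qed

lemma content_eq_0_iff: "content m = 0 \<longleftrightarrow> m = 0"
  by (auto simp: content_def Gcd_0_iff vec_eq_iff)

lemma content_times_primitive_part: "content m *s primitive_part m = m"
proof -
  have "content m dvd m $ i" for i
    unfolding content_def by (rule Gcd_dvd) simp
  then show ?thesis
    by (simp add: vec_eq_iff primitive_part_def)
qed

lemma content_primitive_part:
  assumes "m \<noteq> 0"
  shows "content (primitive_part m) = 1"
proof -
  have "content m * content (primitive_part m) = content m * 1"
    by (simp add: content_scale[symmetric] content_times_primitive_part)
  then show ?thesis using assms content_eq_0_iff[of m] by simp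
qed

lemma primitive_part_scale: "d > 0 \<Longrightarrow> primitive_part (d *s m) = primitive_part m"
  by (simp add: vec_eq_iff primitive_part_def content_scale)

lemma primitive_part_primitive: "content m = 1 \<Longrightarrow> primitive_part m = m"
  by (simp add: vec_eq_iff primitive_part_def)

text \<open>
  On each primitive ray the divisor sums above write \<open>G\<close> as an integral combination of the series
  \<open>- log (1 - z\<^sup>v)\<close>.  Infinitely many \<open>v\<close> occur, but a coefficient of the exponential depends only on the
  coefficients of \<open>G\<close> up to its degree, where a finite combination agrees with \<open>G\<close>.
\<close>
theorem mfps_exp_integral:
  fixes G :: "('N::finite, real) mfps"
  assumes G0: "G 0 = 0"
    and rays: "\<And>v. content v = 1 \<Longrightarrow>
      \<exists>b. gauss_congruences b \<and> (\<forall>e>0. real e * G (e *s v) = of_int (b e))"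
  shows "mfps_integral (mfps_exp G)"
proof -
  obtain b where b: "\<And>v. content v = 1 \<Longrightarrow> gauss_congruences (b v)"
    and Gb: "\<And>v e. content v = 1 \<Longrightarrow> e > 0 \<Longrightarrow> real e * G (e *s v) = of_int (b v e)"
    using rays by metis
  define a where "a m = product_exponent (b (primitive_part m)) (content m)" for m
  have expand: "G m = (\<Sum>v\<in>S. of_int (a v) * log_series v m)"
    if S: "finite S" "0 \<notin> S" "{v. v \<noteq> 0 \<and> mdeg v \<le> mdeg m} \<subseteq> S" and "m \<noteq> 0" for S and m :: "nat ^ 'N"
  proof -
    define e w where "e = content m" and "w = primitive_part m"
    have e: "e > 0" using \<open>m \<noteq> 0\<close> content_eq_0_iff[of m] by (simp add: e_def)
    have w: "content w = 1" "w \<noteq> 0" and m: "m = e *s w"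
      using content_primitive_part[OF \<open>m \<noteq> 0\<close>] content_eq_0_iff[of w]
      by (auto simp: e_def w_def content_times_primitive_part)
    let ?D = "{c. c dvd e}"
    have cpos: "c > 0" if "c \<in> ?D" for c using that e by (auto intro: Nat.gr0I)
    have summand: "of_int (a (c *s w)) * log_series (c *s w) m = of_int (int c * product_exponent (b w) c) / real e"
      if c: "c \<in> ?D" for c
    proof -
      obtain d where d: "e = c * d" using c by blast
      have "c > 0" "d > 0" using d e by auto
      have "m = d *s (c *s w)" by (simp add: m d vec_eq_iff)
      moreover have "c *s w \<noteq> 0" using \<open>c > 0\<close> w by (simp flip: mdeg_eq_0_iff)
      ultimately have "log_series (c *s w) m = 1 / real d"
        using log_series_scale[of "c *s w" d] \<open>d > 0\<close> by simp
      moreover have "a (c *s w) = product_exponent (b w) c"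
        using w \<open>c > 0\<close> by (simp add: a_def content_scale primitive_part_scale primitive_part_primitive)
      ultimately show ?thesis using \<open>c > 0\<close> by (simp add: d)
    qed
    have sub: "(\<lambda>c. c *s w) ` ?D \<subseteq> S"
    proof (rule image_subsetI)
      fix c assume c: "c \<in> ?D"
      then have "c \<le> e" using e by (auto intro: dvd_imp_le)
      then have "mdeg (c *s w) \<le> mdeg m" by (simp add: m)
      moreover have "c *s w \<noteq> 0" using cpos[OF c] w by (simp flip: mdeg_eq_0_iff)
      ultimately show "c *s w \<in> S" using S by blast
    qed
    have zero: "log_series v m = 0" if v: "v \<in> S" "v \<notin> (\<lambda>c. c *s w) ` ?D" for v
    proof (rule log_series_eq_0, rule notI)
      fix d :: nat assume d: "d \<ge> 1" "m = d *s v"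
      have "e = d * content v" by (simp add: e_def d content_scale)
      moreover have "v = content v *s w"
        using d content_times_primitive_part[of v] by (simp add: w_def primitive_part_scale)
      ultimately show False using v by auto
    qed
    have "(\<Sum>v\<in>S. of_int (a v) * log_series v m) =
        (\<Sum>v\<in>(\<lambda>c. c *s w) ` ?D. of_int (a v) * log_series v m)"
      using S sub zero by (intro sum.mono_neutral_right) auto
    also have "\<dots> = (\<Sum>c\<in>?D. of_int (a (c *s w)) * log_series (c *s w) m)"
      using w by (subst sum.reindex) (auto simp: inj_on_def scale_right_inject)
    also have "\<dots> = of_int (\<Sum>c\<in>?D. int c * product_exponent (b w) c) / real e"
      unfolding of_int_sum sum_divide_distrib by (rule sum.cong[OF refl summand])
    also have "\<dots> = of_int (b w e) / real e"
      using gauss_congruences_divisor_sum[OF b[OF w(1)] e] by simp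
    also have "\<dots> = G m"
      using Gb[OF w(1) e] e by (simp add: m field_simps)
    finally show ?thesis ..
  qed
  show ?thesis
    unfolding mfps_integral_def
  proof
    fix m :: "nat ^ 'N"
    define S where "S = {v :: nat ^ 'N. v \<noteq> 0 \<and> mdeg v \<le> mdeg m}"
    define F where "F = (\<lambda>x. \<Sum>v\<in>S. of_int (a v) * log_series v x)"
    have "finite S" unfolding S_def
      by (rule finite_subset[OF _ finite_mdeg_le[of "mdeg m"]]) auto
    have F: "exp_integral F"
      unfolding F_def using \<open>finite S\<close>
      by (intro exp_integral_sum exp_integral_scale_int exp_integral_log_series) (auto simp: S_def)
    have "F x = G x" if "mdeg x \<le> mdeg m" for x
    proof (cases "x = 0")
      case True
      then show ?thesis using F G0 by (simp add: exp_integral_def)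
    next
      case False
      have "{v. v \<noteq> 0 \<and> mdeg v \<le> mdeg x} \<subseteq> S"
        using that by (auto simp: S_def)
      then have "G x = F x"
        unfolding F_def using expand[of S x] \<open>finite S\<close> False by (simp add: S_def)
      then show ?thesis ..
    qed
    then have "mfps_exp G m = mfps_exp F m"
      using mfps_exp_cong[of G m F] G0 by blast
    then show "mfps_exp G m \<in> \<int>"
      using F by (simp add: exp_integral_def mfps_integral_def)
  qed
qed

section \<open>The fundamental solution and its first derivative\<close>

text \<open>
  Each index with negative \<open>k\<^sub>j\<close> contributes exactly one factor vanishing at \<open>t = 0\<close>, the one with
  \<open>b = 0\<close>.  So the order of vanishing is at least \<open>num_neg l n m\<close>, and what is left has a denominator
  that does not vanish at \<open>0\<close>.
\<close>
lemma c_coeff_axis: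
  "c_coeff l n m (axis i t) = t ^ num_neg l n m *
     ((\<Prod>j | j < CARD('N) + n \<and> kint l m j < 0.
        of_int (l i j) * (\<Prod>b = 1..<nat (- kint l m j). - real b + of_int (l i j) * t)) /
      (\<Prod>j | j < CARD('N) + n \<and> kint l m j > 0.
        \<Prod>a = 1..nat (kint l m j). real a + of_int (l i j) * t))"
  for l :: "'N::finite \<Rightarrow> nat \<Rightarrow> int"
proof -
  have "(\<Prod>b<K. - real b + x) = x * (\<Prod>b = 1..<K. - real b + x)" if "K > 0" for K x
    using that by (simp add: lessThan_atLeast0 prod.atLeast_Suc_lessThan)
  then have "(\<Prod>j | j < CARD('N) + n \<and> kint l m j < 0.
        \<Prod>b<nat (- kint l m j). - real b + of_int (l i j) * t) =
      (\<Prod>j | j < CARD('N) + n \<and> kint l m j < 0.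
        t * (of_int (l i j) * (\<Prod>b = 1..<nat (- kint l m j). - real b + of_int (l i j) * t)))"
    by (intro prod.cong) auto
  also have "\<dots> = t ^ num_neg l n m * (\<Prod>j | j < CARD('N) + n \<and> kint l m j < 0.
        of_int (l i j) * (\<Prod>b = 1..<nat (- kint l m j). - real b + of_int (l i j) * t))"
    by (simp add: prod.distrib num_neg_def)
  finally show ?thesis
    by (simp add: c_coeff_def kform_axis)
qed

lemma kint_0 [simp]: "kint l 0 j = 0"
  by (simp add: kint_def kform_def)

lemma kint_scale: "kint l (e *s v) j = int e * kint l v j"
  by (simp add: kint_def kform_def sum_distrib_left ac_simps)

lemma c_coeff_0 [simp]: "c_coeff l n 0 r = 1"
  by (simp add: c_coeff_def)

lemma g0_eq_one:
  fixes l :: "'N::finite \<Rightarrow> nat \<Rightarrow> int"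
  assumes "condition_A l n"
  shows "g0 l n 0 = mfps_one"
proof
  fix m :: "nat ^ 'N"
  show "g0 l n 0 m = mfps_one m"
  proof (cases "m = 0")
    case False
    then have "num_neg l n m \<noteq> 0" using assms by (auto simp: condition_A_def)
    moreover have axis_0: "axis undefined 0 = (0 :: real ^ 'N)"
      by (simp add: axis_def vec_eq_iff)
    ultimately have "c_coeff l n m 0 = 0"
      using c_coeff_axis[of l n m undefined 0] unfolding axis_0 by simp
    then show ?thesis
      using False by (simp add: g0_def omega_def mfps_one_def)
  qed (simp add: g0_def omega_def mfps_one_def)
qed

text \<open>
  After one factor \<open>t\<close> is split off, the derivative at \<open>0\<close> is the value there of the remaining
  continuous function.  The power of \<open>0\<close> is \<open>1\<close> if exactly one \<open>k\<^sub>j\<close> is negative, and \<open>0\<close> if there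
  are more.
\<close>
lemma g1_eq_leading_factor:
  fixes l :: "'N::finite \<Rightarrow> nat \<Rightarrow> int"
  assumes "num_neg l n m > 0"
  shows "g1 l n 0 i m = 0 ^ (num_neg l n m - 1) *
     ((\<Prod>j | j < CARD('N) + n \<and> kint l m j < 0.
        of_int (l i j) * (\<Prod>b = 1..<nat (- kint l m j). - real b)) /
      (\<Prod>j | j < CARD('N) + n \<and> kint l m j > 0. fact (nat (kint l m j))))"
proof -
  define H where "H t =
     ((\<Prod>j | j < CARD('N) + n \<and> kint l m j < 0.
        of_int (l i j) * (\<Prod>b = 1..<nat (- kint l m j). - real b + of_int (l i j) * t)) /
      (\<Prod>j | j < CARD('N) + n \<and> kint l m j > 0.
        \<Prod>a = 1..nat (kint l m j). real a + of_int (l i j) * t))" for t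
  let ?g = "\<lambda>t. t ^ (num_neg l n m - 1) * H t"
  \<comment> \<open>Caratheodory: \<open>g t * t\<close> has derivative \<open>g 0\<close> at \<open>0\<close> when \<open>g\<close> is continuous at \<open>0\<close>.\<close>
  have "isCont ?g 0"
    unfolding H_def by (intro continuous_intros) (auto simp: prod_zero_iff)
  moreover have "c_coeff l n m (axis i t) = ?g t * t" for t
    using assms power_minus_mult[of "num_neg l n m" t] by (simp add: c_coeff_axis H_def mult.commute)
  ultimately have "DERIV (\<lambda>t. c_coeff l n m (axis i t)) 0 :> ?g 0"
    by (intro CARAT_DERIV[THEN iffD2] exI[of _ ?g]) auto
  then have "g1 l n 0 i m = ?g 0"
    by (simp add: g1_def omega_def DERIV_imp_deriv)
  then show ?thesis by (simp add: H_def fact_prod)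
qed

lemma g1_const: "g1 l n 0 i 0 = 0"
  by (simp add: g1_def omega_def)

lemma g1_eq_0: "num_neg l n m > 1 \<Longrightarrow> g1 l n 0 i m = 0"
  by (subst g1_eq_leading_factor) auto

lemma prod_neg: "(\<Prod>b = 1..<Suc K. - real b) = (- 1) ^ K * fact K"
  by (induction K) (auto simp: algebra_simps)

lemma g1_num_neg_1:
  fixes l :: "'N::finite \<Rightarrow> nat \<Rightarrow> int"
  assumes "{j. j < CARD('N) + n \<and> kint l m j < 0} = {j0}"
  shows "g1 l n 0 i m = of_int (l i j0) * (- 1) ^ (nat (- kint l m j0) - 1) * fact (nat (- kint l m j0) - 1) /
      (\<Prod>j | j < CARD('N) + n \<and> kint l m j > 0. fact (nat (kint l m j)))"
proof -
  have num: "num_neg l n m = 1" using assms by (simp add: num_neg_def)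
  have "kint l m j0 < 0" using assms by blast
  then have "nat (- kint l m j0) = Suc (nat (- kint l m j0) - 1)" by simp
  from prod_neg[of "nat (- kint l m j0) - 1", folded this]
  show ?thesis by (simp add: g1_eq_leading_factor num assms)
qed

lemma calabi_yau_sum_kint:
  fixes l :: "'N::finite \<Rightarrow> nat \<Rightarrow> int"
  assumes "calabi_yau l n"
  shows "(\<Sum>j<CARD('N) + n. kint l v j) = 0"
  unfolding kint_def kform_def
  by (subst sum.swap) (use assms in \<open>simp add: calabi_yau_def flip: sum_distrib_right\<close>)

text \<open>
  The vectors \<open>e *s v\<close> have the same signs of \<open>k\<^sub>j\<close> as \<open>v\<close>.  If just one of these is negative, the
  Calabi-Yau condition makes its absolute value \<open>K\<close> the sum of the positive ones, and
  \<open>(e K - 1)! / \<Prod>\<^sub>j (e k\<^sub>j)!\<close> becomes a multinomial coefficient divided by \<open>e * K\<close>.  Condition (B) says that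
  the positive \<open>k\<^sub>j\<close> have no common divisor, which is what the division by \<open>K\<close> requires.
\<close>
lemma g1_rays:
  fixes l :: "'N::finite \<Rightarrow> nat \<Rightarrow> int"
  assumes cy: "calabi_yau l n" and A: "condition_A l n" and B: "condition_B l n"
    and v: "content v = 1"
  shows "\<exists>b. gauss_congruences b \<and> (\<forall>e>0. real e * g1 l n 0 i (e *s v) = of_int (b e))"
proof (cases "num_neg l n v = 1")
  case False
  have "v \<noteq> 0" using v content_eq_0_iff[of v] by auto
  then have "num_neg l n v \<noteq> 0" using A by (auto simp: condition_A_def)
  then have "num_neg l n v > 1" using False by linarith
  moreover have "num_neg l n (e *s v) = num_neg l n v" if "e > 0" for e
    using that by (simp add: num_neg_def kint_scale mult_less_0_iff)
  ultimately have "g1 l n 0 i (e *s v) = 0" if "e > 0" for e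
    using that by (intro g1_eq_0) simp
  then show ?thesis
    by (intro exI[of _ "\<lambda>_. 0"]) (simp add: gauss_congruences_def)
next
  case True
  then obtain j0 where j0: "{j. j < CARD('N) + n \<and> kint l v j < 0} = {j0}"
    unfolding num_neg_def by (auto simp: card_1_singleton_iff)
  define J where "J = {j. j < CARD('N) + n \<and> kint l v j > 0}"
  define k where "k j = nat (kint l v j)" for j
  define K where "K = nat (- kint l v j0)"
  have J: "finite J" and kJ: "\<And>j. j \<in> J \<Longrightarrow> int (k j) = kint l v j"
    by (auto simp: J_def k_def)
  have j0': "j0 < CARD('N) + n" "kint l v j0 < 0" using j0 by blast+
  then have K: "int K = - kint l v j0" "K > 0" by (auto simp: K_def)
  have sum_J: "int K = (\<Sum>j\<in>J. kint l v j)"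
  proof -
    have "0 = (\<Sum>j<CARD('N) + n. kint l v j)"
      using calabi_yau_sum_kint[OF cy, of v] by simp
    also have "\<dots> = (\<Sum>j\<in>insert j0 J. kint l v j)"
      by (rule sum.mono_neutral_right) (use j0 j0' in \<open>force simp: J_def\<close>)+
    also have "\<dots> = kint l v j0 + (\<Sum>j\<in>J. kint l v j)"
      using j0' J by (subst sum.insert) (auto simp: J_def)
    finally show ?thesis using K by simp
  qed
  then have "int (\<Sum>j\<in>J. k j) = int K"
    using kJ by simp
  then have sum_k: "(\<Sum>j\<in>J. k j) = K"
    by (simp only: of_nat_eq_iff)
  have gcd: "Gcd (k ` J) = 1"
  proof -
    let ?g = "int (Gcd (k ` J))"
    have dJ: "?g dvd kint l v j" if "j \<in> J" for j
      using that kJ by (metis Gcd_dvd image_eqI int_dvd_int_iff)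
    have "?g dvd int K"
      unfolding sum_J by (rule dvd_sum) (rule dJ)
    then have dj0: "?g dvd kint l v j0"
      unfolding K by (simp only: dvd_minus_iff)
    have "?g dvd kint l v j" if j: "j < CARD('N) + n" for j
    proof -
      consider "kint l v j < 0" | "kint l v j = 0" | "kint l v j > 0" by linarith
      then show ?thesis
      proof cases
        case 1
        then have "j = j0" using j j0 by blast
        then show ?thesis using dj0 by simp
      next
        case 2
        then show ?thesis by (simp only: dvd_0_right)
      next
        case 3
        then show ?thesis using j by (intro dJ) (simp add: J_def)
      qed
    qed
    then have "?g dvd Gcd (kint l v ` {..<CARD('N) + n})"
      by (intro Gcd_greatest) auto
    also have "\<dots> = 1"
      using B True v by (simp add: condition_B_def content_def)
    finally show ?thesis by simp
  qed
  have g1: "real e * g1 l n 0 i (e *s v) =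
      of_int (l i j0 * (- 1) ^ (e * K + 1) * int (reduced_multinomial J k e))" if e: "e > 0" for e
  proof -
    have neg: "{j. j < CARD('N) + n \<and> kint l (e *s v) j < 0} = {j0}"
      using e j0 by (simp add: kint_scale mult_less_0_iff)
    have pos: "{j. j < CARD('N) + n \<and> kint l (e *s v) j > 0} = J"
      using e by (simp add: kint_scale zero_less_mult_iff J_def)
    have nK: "nat (- kint l (e *s v) j0) = e * K"
    proof -
      have "- kint l (e *s v) j0 = int (e * K)"
        by (simp add: kint_scale K)
      then show ?thesis by (simp only: nat_int)
    qed
    have nk: "nat (kint l (e *s v) j) = e * k j" for j
      by (simp add: kint_scale k_def nat_mult_distrib)
    let ?P = "\<Prod>j\<in>J. fact (e * k j)"
    have P: "(?P :: real) > 0" by (simp add: prod_pos)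
    have eK: "e * K > 0" using e K by simp
    have "K * reduced_multinomial J k e * ?P = fact (e * K)"
      using reduced_multinomial_mult[OF J e gcd] multinomial_mult[OF J, of "\<lambda>j. e * k j"]
      by (simp add: sum_k flip: sum_distrib_left)
    then have "real (K * reduced_multinomial J k e * ?P) = real (fact (e * K))"
      by (simp only:)
    then have "real K * real (reduced_multinomial J k e) * ?P = fact (e * K)"
      by simp
    also have "\<dots> = real K * (real e * fact (e * K - 1))"
      using fact_reduce[OF eK, where 'a = real] by simp
    finally have "real (reduced_multinomial J k e) * ?P = real e * fact (e * K - 1)"
      using K by simp
    then have R: "real (reduced_multinomial J k e) = real e * fact (e * K - 1) / ?P"
      using P by (simp add: field_simps)
    have "(- 1) ^ (e * K - 1) = (- 1 :: real) ^ (e * K + 1)"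
      using eK by (cases "e * K") auto
    then show ?thesis
      unfolding g1_num_neg_1[OF neg] pos nK nk by (simp add: R)
  qed
  then show ?thesis
    using gauss_congruences_signed_reduced_multinomial[OF J gcd] by blast
qed

theorem theorem5p1:
  fixes l :: "'N::finite \<Rightarrow> nat \<Rightarrow> int" and n :: nat
  assumes "n \<ge> 1"
    and "calabi_yau l n"
    and "condition_A l n"
    and "condition_B l n"
  shows "\<forall>i. \<exists>Q. mfps_integral Q \<and> mirror_map l n i = mfps_mult (mfps_var i) Q"
proof
  fix i
  have "mfps_integral (mfps_exp (g1 l n 0 i))"
    using g1_const g1_rays[OF assms(2-4)] by (rule mfps_exp_integral)
  moreover have "mirror_map l n i = mfps_mult (mfps_var i) (mfps_exp (g1 l n 0 i))"
    by (simp add: mirror_map_def g0_eq_one[OF assms(3)] mfps_divide_one)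
  ultimately show "\<exists>Q. mfps_integral Q \<and> mirror_map l n i = mfps_mult (mfps_var i) Q"
    by blast
qed

end
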